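(* Fix a finite generating set of $2V$ consisting of $d$ elements and let $|x|$ denote the corresponding word length of $x\in 2V$. For $n\ge 1$ let $H_n$ be the set of elements of $2V$ representable by a tree-pair diagram with $n$ carets and having no representatives with fewer than $n$ carets. Then the fraction of elements of $H_n$ which have word length greater than $n\log_{2d} n$ converges exponentially fast to $1$; that is, there are constants $C>0$ and $0<\rho<1$ such that for all $n\ge 1$, $$ 1-\frac{\#\{x\in H_n : |x|>n\log_{2d} n\}}{\# H_n}\;\le\; C\rho^{\,n}. $$
   Context: The group $2V$ (Brin's two-dimensional Thompson group). Work in the unit square, using half-open dyadic rectangles $(\frac{i}{2^r},\frac{i+1}{2^r}]\times(\frac{j}{2^s},\frac{j+1}{2^s}]$ with integers $r,s\ge 0$, $0\le i<2^r$, $0\le j<2^s$, so that maps are defined pointwise on $(0,1]^2$. A dyadic rectangle may be halved by a vertical subdivision (into its left and right halves) or by a horizontal subdivision (into its bottom and top halves). A two-type tree is a finite rooted binary tree each of whose carets (an interior vertex together with its two downward edges) is labelled "vertical" or "horizontal". It encodes a partition of the unit square into dyadic rectangles: the root corresponds to the whole square; a vertical caret halves the corresponding rectangle vertically, with left child the left half and right child the right half; a horizontal caret halves it horizontally, with left child the bottom half and right child the top half. The leaves correspond to the rectangles of the partition and are numbered from left to right as leaves of the tree. A tree-pair diagram is a triple $(T_+,\pi,T_-)$ where $T_+,T_-$ are two-type trees with the same number $k$ of leaves and $\pi$ is a permutation of the $k$ leaf labels. It represents the bijection of the square which maps, for each leaf label $i$, the rectangle of leaf $i$ of $T_+$ onto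 the rectangle of leaf $\pi(i)$ of $T_-$ by the affine map of the form $(u,v)\mapsto(au+b,\,cv+d)$ with $a,c>0$. The group $2V$ is the group of all such bijections under composition; it is finitely generated. Different diagrams can represent the same element. The number of carets of a tree-pair diagram is the number of carets in each of its two trees (equal to the number of leaves minus one). Word length with respect to a generating set $S$ is the length of a shortest expression as a product of elements of $S$ and their inverses. *)

theory Defs
  imports "HOL-Algebra.Bij" "HOL-Algebra.Generated_Groups" "HOL-Combinatorics.Permutations"
    Complex_Main
begin

definition unit_square :: "(real \<times> real) set" where
  "unit_square = {0<..1} \<times> {0<..1}"

definition dyadic_rect :: "nat \<Rightarrow> nat \<Rightarrow> nat \<Rightarrow> nat \<Rightarrow> (real \<times> real) set" where
  "dyadic_rect r i s j =
     {real i / 2 ^ r <.. (real i + 1) / 2 ^ r} \<times> {real j / 2 ^ s <.. (real j + 1) / 2 ^ s}"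

datatype caret_type = Vertical | Horizontal

datatype two_type_tree = Leaf | Caret caret_type two_type_tree two_type_tree

primrec carets :: "two_type_tree \<Rightarrow> nat" where
  "carets Leaf = 0"
| "carets (Caret c l r) = Suc (carets l + carets r)"

primrec leaves :: "two_type_tree \<Rightarrow> nat" where
  "leaves Leaf = 1"
| "leaves (Caret c l r) = leaves l + leaves r"

text \<open>The rectangles of the leaves, from left to right, of a tree whose root corresponds to
  the rectangle \<open>dyadic_rect r i s j\<close>. The first coordinate of the square is the horizontal
  one, so a vertical caret (left half, right half) splits the first factor and a horizontal
  caret (bottom half, top half) splits the second.\<close>

fun rects_below :: "two_type_tree \<Rightarrow> nat \<Rightarrow> nat \<Rightarrow> nat \<Rightarrow> nat \<Rightarrow> (real \<times> real) set list" where
  "rects_below Leaf r i s j = [dyadic_rect r i s j]"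
| "rects_below (Caret Vertical T U) r i s j =
     rects_below T (Suc r) (2 * i) s j @ rects_below U (Suc r) (2 * i + 1) s j"
| "rects_below (Caret Horizontal T U) r i s j =
     rects_below T r i (Suc s) (2 * j) @ rects_below U r i (Suc s) (2 * j + 1)"

definition leaf_rects :: "two_type_tree \<Rightarrow> (real \<times> real) set list" where
  "leaf_rects T = rects_below T 0 0 0 0"

definition maps_affinely ::
  "(real \<times> real \<Rightarrow> real \<times> real) \<Rightarrow> (real \<times> real) set \<Rightarrow> (real \<times> real) set \<Rightarrow> bool" where
  "maps_affinely f A B \<longleftrightarrow>
     f ` A = B \<and>
     (\<exists>a b c d. a > 0 \<and> c > 0 \<and> (\<forall>(u, v) \<in> A. f (u, v) = (a * u + b, c * v + d)))"

text \<open>Leaf labels are \<open>0, \<dots>, k - 1\<close>.\<close>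

definition tree_pair_diagram ::
  "two_type_tree \<Rightarrow> (nat \<Rightarrow> nat) \<Rightarrow> two_type_tree \<Rightarrow> bool" where
  "tree_pair_diagram T \<pi> U \<longleftrightarrow> leaves T = leaves U \<and> \<pi> permutes {..<leaves T}"

text \<open>Membership in \<open>Bij unit_square\<close> makes \<open>f\<close> a bijection of the square with the conventional
  value \<open>undefined\<close> outside it, so \<open>f\<close> is determined by its restriction to the square.\<close>

definition represents ::
  "two_type_tree \<Rightarrow> (nat \<Rightarrow> nat) \<Rightarrow> two_type_tree \<Rightarrow> (real \<times> real \<Rightarrow> real \<times> real) \<Rightarrow> bool" where
  "represents T \<pi> U f \<longleftrightarrow>
     tree_pair_diagram T \<pi> U \<and> f \<in> Bij unit_square \<and>
     (\<forall>i < leaves T. maps_affinely f (leaf_rects T ! i) (leaf_rects U ! \<pi> i))"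

definition two_V :: "(real \<times> real \<Rightarrow> real \<times> real) monoid" where
  "two_V = (BijGroup unit_square) \<lparr>carrier := {f. \<exists>T \<pi> U. represents T \<pi> U f}\<rparr>"

lemma leaves_eq_carets: "leaves T = carets T + 1"
  by (induction T) auto

lemma length_leaf_rects: "length (leaf_rects T) = leaves T"
proof -
  have "length (rects_below T r i s j) = leaves T" for r i s j
    by (induction T r i s j rule: rects_below.induct) auto
  then show ?thesis
    by (simp add: leaf_rects_def)
qed

text \<open>By \<open>leaves_eq_carets\<close> both trees of a diagram have the same number of carets.\<close>

definition representable_with :: "nat \<Rightarrow> (real \<times> real \<Rightarrow> real \<times> real) \<Rightarrow> bool" where
  "representable_with n f \<longleftrightarrow> (\<exists>T \<pi> U. represents T \<pi> U f \<and> carets T = n)"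

definition H_set :: "nat \<Rightarrow> (real \<times> real \<Rightarrow> real \<times> real) set" where
  "H_set n = {x \<in> carrier two_V. representable_with n x \<and> (\<forall>m < n. \<not> representable_with m x)}"

text \<open>Only meaningful for \<open>x\<close> in the subgroup generated by \<open>S\<close>; otherwise the set of lengths is
  empty and \<open>LEAST\<close> is unspecified.\<close>

definition word_length :: "('a, 'b) monoid_scheme \<Rightarrow> 'a set \<Rightarrow> 'a \<Rightarrow> nat" where
  "word_length G S x =
     (LEAST n. \<exists>ws. length ws = n \<and> set ws \<subseteq> S \<union> m_inv G ` S \<and>
                    foldr (\<otimes>\<^bsub>G\<^esub>) ws \<one>\<^bsub>G\<^esub> = x)"

end

theory Submission
  imports Defs
begin

text \<open>
  The proof compares two counts. A word of length at most \<open>L\<close> in \<open>d\<close> generators and their inverses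
  is one of at most \<open>2 * (2 * d) ^ L\<close>, so at most \<open>2 * n ^ n\<close> elements have length at most
  \<open>n * log (2 * d) n\<close> (\<open>card_short_words\<close>, \<open>power_floor_le_self_power\<close>). It therefore suffices that
  \<open>H_set n\<close> exceeds \<open>n ^ n\<close> by an exponential factor.

  For this lower bound (\<open>card_H_set_ge\<close>) a family of diagrams with one and the same source tree is
  large enough. The source is the comb that halves the leftmost strip
  again and again. The target is a caterpillar: every caret has a leaf as one of its children, and
  both the type of the caret and the side of that leaf are free, except for three carets. This gives
  \<open>4 ^ (n - 3)\<close> targets. The permutation fixes label \<open>0\<close> and is otherwise free, which gives \<open>n!\<close>
  permutations. Since \<open>n! \<ge> (n / 3) ^ n\<close>, the family has at least
  \<open>(4 / 3) ^ n * n ^ n / 64\<close> members, and the fraction in question is at most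
  \<open>128 * (3 / 4) ^ n\<close>.

  Two facts make the family count. Different members give different bijections
  (\<open>represents_caterpillar_inj\<close>): the images of the comb rectangles are the rectangles of the target
  partition, and a caterpillar can be read off from its partition by peeling off one half at a time.
  And no member has a diagram with fewer carets (\<open>comb_diagram_minimal\<close>): the top right corners of
  the \<open>n + 1\<close> comb strips lie on the top edge of the square, so with fewer leaves two of them lie in
  one leaf rectangle, and such a dyadic rectangle meets the two thinnest strips. But those two strips
  are mapped to rectangles of different heights, so the bijection stretches them differently in the
  vertical direction.

  The quotient is only meaningful because \<open>H_set n\<close> is finite, which holds because a diagram
  determines the bijection that it represents (\<open>represents_unique\<close>).
\<close>

section \<open>Dyadic cells and their halves\<close>

text \<open>Arguments about trees are by induction with the starting rectangle generalized. They run on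
  the index quadruples of dyadic rectangles, because there the two caret types can be treated
  uniformly, as the halving of a cell in one of two directions.\<close>

type_synonym cell = "nat \<times> nat \<times> nat \<times> nat"

fun region :: "cell \<Rightarrow> (real \<times> real) set" where
  "region (r, i, s, j) = dyadic_rect r i s j"

text \<open>The flag selects the right or top half.\<close>

fun half :: "caret_type \<Rightarrow> bool \<Rightarrow> cell \<Rightarrow> cell" where
  "half Vertical b (r, i, s, j) = (Suc r, 2 * i + of_bool b, s, j)"
| "half Horizontal b (r, i, s, j) = (r, i, Suc s, 2 * j + of_bool b)"

fun leaf_cells :: "two_type_tree \<Rightarrow> cell \<Rightarrow> cell list" where
  "leaf_cells Leaf q = [q]"
| "leaf_cells (Caret c T U) q = leaf_cells T (half c False q) @ leaf_cells U (half c True q)"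

abbreviation root_cell :: cell where
  "root_cell \<equiv> (0, 0, 0, 0)"

text \<open>The region of a cell with exponent \<open>s\<close> has height \<open>1 / 2 ^ s\<close>.\<close>

abbreviation height_exponent :: "cell \<Rightarrow> nat" where
  "height_exponent q \<equiv> fst (snd (snd q))"

lemma rects_below_eq_map_region: "rects_below T r i s j = map region (leaf_cells T (r, i, s, j))"
  by (induction T r i s j rule: rects_below.induct) auto

lemma leaf_rects_eq_map_region: "leaf_rects T = map region (leaf_cells T root_cell)"
  by (simp add: leaf_rects_def rects_below_eq_map_region)

lemma length_leaf_cells [simp]: "length (leaf_cells T q) = leaves T"
  by (induction T arbitrary: q) auto

lemma leaf_rects_nth: "i < leaves T \<Longrightarrow> leaf_rects T ! i = region (leaf_cells T root_cell ! i)"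
  by (simp add: leaf_rects_eq_map_region)

lemma region_root_cell: "region root_cell = unit_square"
  by (simp add: dyadic_rect_def unit_square_def)

lemma region_nonempty: "region q \<noteq> {}"
  by (cases q) (auto simp: dyadic_rect_def divide_simps)

declare region.simps [simp del]

lemma region_half:
  "region (half Vertical False (r, i, s, j)) =
     {real i / 2 ^ r <.. (real i + 1/2) / 2 ^ r} \<times> {real j / 2 ^ s <.. (real j + 1) / 2 ^ s}"
  "region (half Vertical True (r, i, s, j)) =
     {(real i + 1/2) / 2 ^ r <.. (real i + 1) / 2 ^ r} \<times> {real j / 2 ^ s <.. (real j + 1) / 2 ^ s}"
  "region (half Horizontal False (r, i, s, j)) =
     {real i / 2 ^ r <.. (real i + 1) / 2 ^ r} \<times> {real j / 2 ^ s <.. (real j + 1/2) / 2 ^ s}"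
  "region (half Horizontal True (r, i, s, j)) =
     {real i / 2 ^ r <.. (real i + 1) / 2 ^ r} \<times> {(real j + 1/2) / 2 ^ s <.. (real j + 1) / 2 ^ s}"
  by (simp_all add: region.simps dyadic_rect_def add_divide_distrib add.commute)

lemma region_half_disjoint: "region (half c False q) \<inter> region (half c True q) = {}"
  by (cases q; cases c) (auto simp only: region_half, auto)

lemma region_half_union: "region q = region (half c False q) \<union> region (half c True q)"
proof -
  have "{real i / 2 ^ k <.. (real i + 1) / 2 ^ k} =
      {real i / 2 ^ k <.. (real i + 1/2) / 2 ^ k} \<union> {(real i + 1/2) / 2 ^ k <.. (real i + 1) / 2 ^ k}"
    for i k
    by (rule ivl_disj_un_two(6)[symmetric]) (simp_all add: divide_right_mono)
  note * = this
  obtain r i s j where "q = (r, i, s, j)" by (metis prod_cases4)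
  then show ?thesis
    by (cases c)
      (simp_all only: region_half region.simps dyadic_rect_def *[of i r] flip: Sigma_Un_distrib1,
        simp only: *[of j s] Times_Un_distrib1 Sigma_Un_distrib2)
qed

lemma region_half_subset: "region (half c b q) \<subseteq> region q"
  using region_half_union[of q c] by (cases b) auto

lemma greaterThanAtMost_subset_iff:
  fixes a b c d :: real
  assumes "a < b"
  shows "{a<..b} \<subseteq> {c<..d} \<longleftrightarrow> c \<le> a \<and> b \<le> d"
proof
  assume sub: "{a<..b} \<subseteq> {c<..d}"
  have "c \<le> a"
  proof (rule ccontr)
    assume "\<not> c \<le> a"
    then have "min b c \<in> {a<..b}" using assms by auto
    then have "min b c \<in> {c<..d}" using sub by blast
    then show False by auto
  qed
  then show "c \<le> a \<and> b \<le> d" using sub assms by auto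
qed auto

text \<open>The four halves of one rectangle are pairwise incomparable. This one fact gives both the
  strictness of subdivision and the decoding of caterpillars.\<close>

lemma region_half_subset_half:
  assumes "region (half c b q) \<subseteq> region (half c' b' q)"
  shows "c = c' \<and> b = b'"
proof -
  have lt: "x / 2 ^ k < y / 2 ^ k \<longleftrightarrow> x < y" and le: "x / 2 ^ k \<le> y / 2 ^ k \<longleftrightarrow> x \<le> y"
    for x y :: real and k
    by (simp_all add: divide_less_cancel divide_le_cancel)
  show ?thesis
    using assms
    by (cases q; cases c; cases c'; cases b; cases b')
      (simp_all only: region_half times_subset_iff greaterThanAtMost_empty_iff lt,
        simp_all add: greaterThanAtMost_subset_iff lt le)
qed

section \<open>The partition encoded by a tree\<close>

lemma leaf_cells_subset: "p \<in> set (leaf_cells T q) \<Longrightarrow> region p \<subseteq> region q"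
proof (induction T arbitrary: q)
  case (Caret c T U)
  from Caret.prems have "p \<in> set (leaf_cells T (half c False q)) \<or> p \<in> set (leaf_cells U (half c True q))"
    by simp
  then show ?case using Caret.IH region_half_subset by (meson order_trans)
qed simp

lemma leaf_cells_cover: "(\<Union>p\<in>set (leaf_cells T q). region p) = region q"
proof (induction T arbitrary: q)
  case (Caret c T U)
  then show ?case using region_half_union[of q c] by simp
qed simp

lemma leaf_cells_disjoint:
  "i < j \<Longrightarrow> j < leaves T \<Longrightarrow> region (leaf_cells T q ! i) \<inter> region (leaf_cells T q ! j) = {}"
proof (induction T arbitrary: q i j)
  case Leaf
  then have False by simp
  then show ?case ..
next
  case (Caret c T U)
  have L: "region (leaf_cells T (half c False q) ! k) \<subseteq> region (half c False q)" if "k < leaves T" for k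
    using that leaf_cells_subset by (metis length_leaf_cells nth_mem)
  have R: "region (leaf_cells U (half c True q) ! k) \<subseteq> region (half c True q)" if "k < leaves U" for k
    using that leaf_cells_subset by (metis length_leaf_cells nth_mem)
  consider "j < leaves T" | "i < leaves T" "leaves T \<le> j" | "leaves T \<le> i" using Caret.prems by linarith
  then show ?case
  proof cases
    case 1
    then have "region (leaf_cells T (half c False q) ! i) \<inter> region (leaf_cells T (half c False q) ! j) = {}"
      by (rule Caret.IH(1)[OF Caret.prems(1)])
    then show ?thesis using 1 Caret.prems(1) by (simp only: leaf_cells.simps nth_append) simp
  next
    case 2
    then have "region (leaf_cells (Caret c T U) q ! i) \<subseteq> region (half c False q)"
      "region (leaf_cells (Caret c T U) q ! j) \<subseteq> region (half c True q)"
      using Caret.prems(2) L[of i] R[of "j - leaves T"] by (simp_all add: nth_append)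
    from Int_mono[OF this] show ?thesis by (simp only: region_half_disjoint subset_empty)
  next
    case 3
    have "region (leaf_cells U (half c True q) ! (i - leaves T)) \<inter>
        region (leaf_cells U (half c True q) ! (j - leaves T)) = {}"
      by (rule Caret.IH(2)) (use 3 Caret.prems in auto)
    then show ?thesis using 3 Caret.prems(1) by (simp only: leaf_cells.simps nth_append) simp
  qed
qed

lemma disjoint_family_on_leaf_cells:
  "disjoint_family_on (\<lambda>i. region (leaf_cells T q ! i)) {..<leaves T}"
  unfolding disjoint_family_on_def
proof (intro ballI impI)
  fix i j assume "i \<in> {..<leaves T}" "j \<in> {..<leaves T}" "i \<noteq> j"
  then show "region (leaf_cells T q ! i) \<inter> region (leaf_cells T q ! j) = {}"
    using leaf_cells_disjoint[of i j T q] leaf_cells_disjoint[of j i T q] by (cases "i < j") auto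
qed

lemma UN_leaf_cells_nth: "(\<Union>i<leaves T. region (leaf_cells T q ! i)) = region q"
proof -
  have "set (leaf_cells T q) = (!) (leaf_cells T q) ` {..<leaves T}"
    by (metis atLeast_upt image_set length_leaf_cells map_nth)
  then show ?thesis by (simp add: leaf_cells_cover[of T q, symmetric])
qed

lemma leaf_cells_region_inj:
  assumes "i < leaves T" "j < leaves T"
    and "region (leaf_cells T q ! i) = region (leaf_cells T q ! j)"
  shows "i = j"
proof (rule ccontr)
  assume "i \<noteq> j"
  then have "region (leaf_cells T q ! i) \<inter> region (leaf_cells T q ! j) = {}"
    using disjoint_family_onD[OF disjoint_family_on_leaf_cells[of T q], of i j] assms(1,2) by simp
  then show False using assms(3) region_nonempty by (metis inf.idem)
qed

lemma leaf_cells_Caret_strict: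
  assumes "p \<in> set (leaf_cells (Caret c T U) q)"
  shows "region p \<noteq> region q"
proof
  assume eq: "region p = region q"
  obtain b where "region p \<subseteq> region (half c b q)"
  proof -
    from assms have "p \<in> set (leaf_cells T (half c False q)) \<or> p \<in> set (leaf_cells U (half c True q))"
      by simp
    then show thesis using that leaf_cells_subset by blast
  qed
  then have "region (half c (\<not> b) q) \<subseteq> region (half c b q)"
    using eq region_half_subset by blast
  then show False using region_half_subset_half by blast
qed

section \<open>Affine maps between dyadic rectangles\<close>

text \<open>The only increasing coordinatewise affine map from the first region onto the second.\<close>

fun stretch :: "cell \<Rightarrow> cell \<Rightarrow> real \<times> real \<Rightarrow> real \<times> real" where
  "stretch (r, i, s, j) (r', i', s', j') (u, v) =
     ((2 ^ r * u - i + i') / 2 ^ r', (2 ^ s * v - j + j') / 2 ^ s')"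

lemma stretch_stretch: "stretch p q (stretch q p x) = x"
  by (cases p; cases q; cases x) simp

lemma mem_dyadic_interval_iff:
  fixes x :: real
  shows "x \<in> {real i / 2 ^ r <.. (real i + 1) / 2 ^ r} \<longleftrightarrow> real i < 2 ^ r * x \<and> 2 ^ r * x \<le> real i + 1"
  by (simp add: pos_divide_less_eq pos_le_divide_eq mult.commute)

lemma stretch_mem: "x \<in> region p \<Longrightarrow> stretch p q x \<in> region q"
  by (cases p; cases q; cases x) (auto simp only: dyadic_rect_def region.simps stretch.simps
    mem_Sigma_iff mem_dyadic_interval_iff; simp)

lemma stretch_bij_betw: "bij_betw (stretch p q) (region p) (region q)"
  by (rule bij_betw_byWitness[where f' = "stretch q p"]) (auto simp: stretch_stretch stretch_mem)

lemma greaterThanAtMost_image_affine: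
  fixes a b x y :: real
  assumes "a > 0"
  shows "(\<lambda>u. a * u + b) ` {x<..y} = {a * x + b<..a * y + b}"
proof -
  have "t \<in> (\<lambda>u. a * u + b) ` {x<..y}" if "t \<in> {a * x + b<..a * y + b}" for t
    by (rule image_eqI[where x = "(t - b) / a"]) (use that assms in \<open>auto simp: field_simps\<close>)
  then show ?thesis using assms by auto
qed

text \<open>An increasing affine map sends endpoints to endpoints, which determines both coefficients.\<close>

lemma affine_onto_dyadic_interval:
  fixes a b :: real
  assumes "a > 0"
    and "(\<lambda>u. a * u + b) ` {real i / 2 ^ r <.. (real i + 1) / 2 ^ r} =
      {real i' / 2 ^ r' <.. (real i' + 1) / 2 ^ r'}"
  shows "a * u + b = (2 ^ r * u - i + i') / 2 ^ r'"
proof -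
  have lt: "real i / 2 ^ r < (real i + 1) / 2 ^ r" "real i' / 2 ^ r' < (real i' + 1) / 2 ^ r'"
    by (simp_all add: divide_strict_right_mono)
  have eq: "{a * (real i / 2 ^ r) + b <.. a * ((real i + 1) / 2 ^ r) + b} =
      {real i' / 2 ^ r' <.. (real i' + 1) / 2 ^ r'}"
    using assms greaterThanAtMost_image_affine by metis
  have lt': "a * (real i / 2 ^ r) + b < a * ((real i + 1) / 2 ^ r) + b"
    by (intro add_strict_right_mono mult_strict_left_mono lt(1) assms(1))
  have e: "a * (real i / 2 ^ r) + b = real i' / 2 ^ r'"
    "a * ((real i + 1) / 2 ^ r) + b = (real i' + 1) / 2 ^ r'"
    using eq greaterThanAtMost_subset_iff[OF lt'] greaterThanAtMost_subset_iff[OF lt(2)]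
    by (metis order_antisym order_refl)+
  then have "a / 2 ^ r = 1 / 2 ^ r'"
    by (simp add: add_divide_distrib distrib_left)
  then have a: "a = 2 ^ r / 2 ^ r'" by (simp add: field_simps)
  show ?thesis using e(1) unfolding a by (simp add: field_simps)
qed

lemma maps_affinely_iff_stretch:
  "maps_affinely f (region p) (region q) \<longleftrightarrow> (\<forall>x\<in>region p. f x = stretch p q x)"
proof
  assume *: "\<forall>x\<in>region p. f x = stretch p q x"
  then have "f ` region p = region q"
    using stretch_bij_betw[of p q] by (metis bij_betw_def image_cong)
  moreover obtain a b c d where "a > 0" "c > 0" and ab: "\<And>u v. stretch p q (u, v) = (a * u + b, c * v + d)"
  proof -
    obtain r i s j r' i' s' j' where "p = (r, i, s, j)" "q = (r', i', s', j')"
      by (metis prod_cases4)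
    then have "stretch p q (u, v) = (2 ^ r / 2 ^ r' * u + (real i' - i) / 2 ^ r',
        2 ^ s / 2 ^ s' * v + (real j' - j) / 2 ^ s')" for u v
      by (simp add: add_divide_distrib diff_divide_distrib)
    then show thesis
      by (rule that[of "2 ^ r / 2 ^ r'" "2 ^ s / 2 ^ s'" "(real i' - i) / 2 ^ r'" "(real j' - j) / 2 ^ s'", rotated 2]) simp_all
  qed
  moreover have "\<forall>(u, v)\<in>region p. f (u, v) = (a * u + b, c * v + d)"
    by (auto simp only: * ab)
  ultimately show "maps_affinely f (region p) (region q)"
    unfolding maps_affinely_def by blast
next
  assume *: "maps_affinely f (region p) (region q)"
  obtain r i s j r' i' s' j' where pq: "p = (r, i, s, j)" "q = (r', i', s', j')"
    by (metis prod_cases4)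
  define A B A' B' where "A = {real i / 2 ^ r <.. (real i + 1) / 2 ^ r}"
    and "B = {real j / 2 ^ s <.. (real j + 1) / 2 ^ s}"
    and "A' = {real i' / 2 ^ r' <.. (real i' + 1) / 2 ^ r'}"
    and "B' = {real j' / 2 ^ s' <.. (real j' + 1) / 2 ^ s'}"
  note defs = A_def B_def A'_def B'_def
  have p: "region p = A \<times> B" and q: "region q = A' \<times> B'"
    by (simp_all add: pq defs region.simps dyadic_rect_def)
  obtain a b c d where f: "f ` (A \<times> B) = A' \<times> B'" "a > 0" "c > 0"
    "\<forall>(u, v)\<in>A \<times> B. f (u, v) = (a * u + b, c * v + d)"
    using * unfolding maps_affinely_def p q by blast
  have "f ` (A \<times> B) = (\<lambda>(u, v). (a * u + b, c * v + d)) ` (A \<times> B)"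
    using f(4) by (intro image_cong) auto
  then have "A' \<times> B' = (\<lambda>u. a * u + b) ` A \<times> (\<lambda>v. c * v + d) ` B"
    using f(1) by (simp add: image_paired_Times)
  moreover have "A \<noteq> {}" "B \<noteq> {}"
    by (simp_all add: defs divide_strict_right_mono)
  ultimately have "(\<lambda>u. a * u + b) ` A = A'" "(\<lambda>v. c * v + d) ` B = B'"
    by (auto simp: times_eq_iff)
  then have "a * u + b = (2 ^ r * u - i + i') / 2 ^ r'" "c * v + d = (2 ^ s * v - j + j') / 2 ^ s'"
    for u v
    using affine_onto_dyadic_interval[OF f(2), of b i r i' r' u]
      affine_onto_dyadic_interval[OF f(3), of d j s j' s' v] unfolding defs by blast+
  then show "\<forall>x\<in>region p. f x = stretch p q x"
    using f(4) unfolding p by (auto simp: pq)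
qed

section \<open>Bijections represented by diagrams\<close>

lemma tree_pair_diagram_less:
  assumes "tree_pair_diagram T \<pi> U" "i < leaves T"
  shows "\<pi> i < leaves U"
proof -
  have "leaves T = leaves U" "\<pi> permutes {..<leaves T}"
    using assms(1) by (auto simp only: tree_pair_diagram_def)
  then show ?thesis using assms(2) permutes_in_image by fastforce
qed

lemma represents_iff_stretch:
  "represents T \<pi> U f \<longleftrightarrow> tree_pair_diagram T \<pi> U \<and> f \<in> Bij unit_square \<and>
     (\<forall>i<leaves T. \<forall>x\<in>region (leaf_cells T root_cell ! i).
        f x = stretch (leaf_cells T root_cell ! i) (leaf_cells U root_cell ! \<pi> i) x)"
  using tree_pair_diagram_less[of T \<pi> U]
  by (auto simp: represents_def leaf_rects_nth maps_affinely_iff_stretch)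

lemma represents_image:
  assumes "represents T \<pi> U f" "i < leaves T"
  shows "f ` region (leaf_cells T root_cell ! i) = region (leaf_cells U root_cell ! \<pi> i)"
  using assms tree_pair_diagram_less[of T \<pi> U i]
  by (simp add: represents_def maps_affinely_def leaf_rects_nth)

lemma unit_square_leaf:
  assumes "x \<in> unit_square"
  obtains i where "i < leaves T" "x \<in> region (leaf_cells T root_cell ! i)"
  using assms UN_leaf_cells_nth[of T root_cell] region_root_cell by blast

text \<open>The affine pieces glue because the leaf regions partition the square on either side.\<close>

lemma represents_exists:
  assumes "tree_pair_diagram T \<pi> U"
  shows "\<exists>f. represents T \<pi> U f"
proof -
  let ?A = "\<lambda>i. region (leaf_cells T root_cell ! i)"
  let ?B = "\<lambda>i. region (leaf_cells U root_cell ! i)"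
  define ix where "ix x = (THE i. i < leaves T \<and> x \<in> ?A i)" for x
  define f where "f = (\<lambda>x\<in>unit_square.
    stretch (leaf_cells T root_cell ! ix x) (leaf_cells U root_cell ! \<pi> (ix x)) x)"
  have perm: "\<pi> permutes {..<leaves T}" and lv: "leaves T = leaves U"
    using assms by (auto simp only: tree_pair_diagram_def)
  have ix: "ix x = i" if "i < leaves T" "x \<in> ?A i" for i x
    unfolding ix_def using that disjoint_family_on_leaf_cells[of T root_cell]
    by (intro the_equality) (auto simp: disjoint_family_on_def)
  have sq: "?A i \<subseteq> unit_square" if "i < leaves T" for i
    using UN_leaf_cells_nth[of T root_cell] region_root_cell that by blast
  have f: "f x = stretch (leaf_cells T root_cell ! i) (leaf_cells U root_cell ! \<pi> i) x"
    if "i < leaves T" "x \<in> ?A i" for i x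
    using sq[OF that(1)] that ix[OF that] by (auto simp: f_def)
  have "bij_betw f (\<Union>i<leaves T. ?A i) (\<Union>i<leaves T. ?B (\<pi> i))"
  proof (rule bij_betw_UNION_disjoint)
    show "disjoint_family_on (\<lambda>i. ?B (\<pi> i)) {..<leaves T}"
      unfolding disjoint_family_on_def
    proof (intro ballI impI)
      fix i j assume ij: "i \<in> {..<leaves T}" "j \<in> {..<leaves T}" "i \<noteq> j"
      then have "\<pi> i < leaves U" "\<pi> j < leaves U" "\<pi> i \<noteq> \<pi> j"
        using tree_pair_diagram_less[OF assms] permutes_inj[OF perm] by (auto dest: injD)
      then show "?B (\<pi> i) \<inter> ?B (\<pi> j) = {}"
        using disjoint_family_on_leaf_cells[of U root_cell] by (simp add: disjoint_family_on_def)
    qed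
    show "bij_betw f (?A i) (?B (\<pi> i))" if "i \<in> {..<leaves T}" for i
      using bij_betw_cong[THEN iffD2, OF f stretch_bij_betw] that by blast
  qed
  moreover have "(\<Union>i<leaves T. ?B (\<pi> i)) = (\<Union>i<leaves U. ?B i)"
  proof -
    have "(\<Union>i<leaves T. ?B (\<pi> i)) = (\<Union>i\<in>\<pi> ` {..<leaves T}. ?B i)" by blast
    then show ?thesis by (simp only: permutes_image[OF perm] lv[symmetric])
  qed
  ultimately have "bij_betw f unit_square unit_square"
    by (simp only: UN_leaf_cells_nth region_root_cell)
  then have "f \<in> Bij unit_square" by (simp add: Bij_def f_def)
  then show ?thesis
    unfolding represents_iff_stretch using f assms by blast
qed

lemma represents_unique:
  assumes "represents T \<pi> U f" "represents T \<pi> U g"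
  shows "f = g"
proof (rule extensionalityI[of f unit_square])
  show "f \<in> extensional unit_square" "g \<in> extensional unit_square"
    using assms by (auto simp: represents_def Bij_def)
  show "f x = g x" if "x \<in> unit_square" for x
    using that unit_square_leaf[of x T] assms by (metis represents_iff_stretch)
qed

lemma finite_trees: "finite {T. carets T = n}"
proof (induction n rule: less_induct)
  case (less n)
  define B where "B = {T. carets T < n}"
  have "B = (\<Union>m<n. {T. carets T = m})" by (auto simp: B_def)
  then have "finite B" using less by auto
  moreover have "finite (UNIV :: caret_type set)"
    by (rule finite_subset[of _ "{Vertical, Horizontal}"]) (use caret_type.exhaust in auto)
  ultimately have fin: "finite (insert Leaf ((\<lambda>(c, T, U). Caret c T U) ` (UNIV \<times> B \<times> B)))"
    by auto
  have "{T. carets T = n} \<subseteq> insert Leaf ((\<lambda>(c, T, U). Caret c T U) ` (UNIV \<times> B \<times> B))"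
  proof
    fix T assume T: "T \<in> {T. carets T = n}"
    show "T \<in> insert Leaf ((\<lambda>(c, T, U). Caret c T U) ` (UNIV \<times> B \<times> B))"
    proof (cases T)
      case (Caret c L R)
      then have "L \<in> B" "R \<in> B" using T by (auto simp: B_def)
      then show ?thesis using Caret by (auto intro: image_eqI[where x = "(c, L, R)"])
    qed simp
  qed
  then show ?case using fin finite_subset by blast
qed

lemma finite_representable_with: "finite {f. representable_with n f}"
proof -
  let ?D = "{T. carets T = n} \<times> {\<pi>. \<pi> permutes {..<Suc n}} \<times> {U. carets U = n}"
  let ?f = "\<lambda>(T, \<pi>, U). THE f. represents T \<pi> U f"
  have "f \<in> ?f ` ?D" if rep: "representable_with n f" for f
  proof -
    obtain T \<pi> U where f: "represents T \<pi> U f" and n: "carets T = n"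
      using rep unfolding representable_with_def by blast
    have "tree_pair_diagram T \<pi> U" using f by (simp add: represents_def)
    then have lv: "leaves T = leaves U" and perm: "\<pi> permutes {..<leaves T}"
      by (auto simp only: tree_pair_diagram_def)
    have "(T, \<pi>, U) \<in> ?D" using lv perm n by (simp add: leaves_eq_carets)
    moreover have "(THE f. represents T \<pi> U f) = f"
      using f represents_unique[OF _ f] by (intro the_equality)
    then have "f = ?f (T, \<pi>, U)" by simp
    ultimately show ?thesis by (rule rev_image_eqI)
  qed
  then have "{f. representable_with n f} \<subseteq> ?f ` ?D" by blast
  moreover have "finite ?D"
    by (intro finite_cartesian_product finite_trees finite_permutations finite_lessThan)
  ultimately show ?thesis by (rule finite_surj[rotated])
qed

lemma finite_H_set: "finite (H_set n)"
  by (rule finite_subset[OF _ finite_representable_with[of n]]) (auto simp: H_set_def)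

section \<open>Combs against caterpillars\<close>

text \<open>The source of every diagram in the family; its leaves \<open>0\<close> and \<open>1\<close> are the two thinnest strips,
  of equal width.\<close>

fun left_comb :: "nat \<Rightarrow> two_type_tree" where
  "left_comb 0 = Leaf"
| "left_comb (Suc n) = Caret Vertical (left_comb n) Leaf"

lemma carets_left_comb [simp]: "carets (left_comb n) = n"
  by (induction n) auto

lemma leaf_cells_left_comb:
  "\<exists>cs. leaf_cells (left_comb (Suc n)) (r, 0, 0, 0) = (r + Suc n, 0, 0, 0) # (r + Suc n, 1, 0, 0) # cs"
proof (induction n arbitrary: r)
  case (Suc n)
  from Suc[of "Suc r"] obtain cs where
    "leaf_cells (left_comb (Suc n)) (Suc r, 0, 0, 0) =
       (Suc r + Suc n, 0, 0, 0) # (Suc r + Suc n, 1, 0, 0) # cs" ..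
  then show ?case by (simp add: left_comb.simps(2)[of "Suc n"] del: left_comb.simps)
qed simp

text \<open>Each letter gives the type of a caret and the side of its leaf child. The last caret is
  prescribed: both of its children are leaves, so the side of the leaf would be ambiguous there.\<close>

fun caterpillar :: "(caret_type \<times> bool) list \<Rightarrow> two_type_tree" where
  "caterpillar [] = Caret Vertical Leaf Leaf"
| "caterpillar ((c, b) # w) =
     (if b then Caret c (caterpillar w) Leaf else Caret c Leaf (caterpillar w))"

lemma carets_caterpillar [simp]: "carets (caterpillar w) = Suc (length w)"
  by (induction w rule: caterpillar.induct) auto

lemma set_leaf_cells_caterpillar:
  "set (leaf_cells (caterpillar ((c, b) # w)) q) =
     insert (half c b q) (set (leaf_cells (caterpillar w) (half c (\<not> b) q)))"
  by auto

lemma leaf_cells_caterpillar_strict: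
  assumes "p \<in> set (leaf_cells (caterpillar w) q)"
  shows "region p \<subset> region q"
proof -
  obtain c T U where "caterpillar w = Caret c T U"
    by (metis caterpillar.elims)
  then show ?thesis
    using assms leaf_cells_Caret_strict leaf_cells_subset by (metis psubsetI)
qed

text \<open>The first half \<open>H\<close> peeled off by \<open>w\<close> must be a rectangle of the partition of \<open>w'\<close>. Either it is
  the half peeled off by \<open>w'\<close>, or it is strictly inside the complementary half, which is impossible
  for two halves of the same rectangle. Removing \<open>H\<close> from both partitions leaves partitions of the
  same smaller rectangle.\<close>

lemma caterpillar_inj:
  assumes "region ` set (leaf_cells (caterpillar w) q) = region ` set (leaf_cells (caterpillar w') q)"
    and "length w = length w'"
  shows "w = w'"
  using assms
proof (induction w arbitrary: w' q)
  case (Cons cb w)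
  obtain c b where cb: "cb = (c, b)" by (cases cb)
  obtain c' b' v where w': "w' = (c', b') # v"
    using Cons.prems(2) by (cases w') auto
  let ?A = "region ` set (leaf_cells (caterpillar w) (half c (\<not> b) q))"
  let ?A' = "region ` set (leaf_cells (caterpillar v) (half c' (\<not> b') q))"
  have eq: "insert (region (half c b q)) ?A = insert (region (half c' b' q)) ?A'"
    using Cons.prems(1) unfolding cb w' set_leaf_cells_caterpillar image_insert .
  have same: "c = c' \<and> b = b'"
  proof -
    have "region (half c b q) = region (half c' b' q) \<or> region (half c b q) \<in> ?A'"
      using eq by blast
    then show ?thesis
    proof
      assume "region (half c b q) = region (half c' b' q)"
      then show ?thesis using region_half_subset_half by blast
    next
      assume "region (half c b q) \<in> ?A'"
      then have "region (half c b q) \<subset> region (half c' (\<not> b') q)"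
        using leaf_cells_caterpillar_strict by blast
      then show ?thesis using region_half_subset_half by blast
    qed
  qed
  have notin: "region (half c b q) \<notin> region ` set (leaf_cells (caterpillar u) (half c (\<not> b) q))" for u
  proof
    assume "region (half c b q) \<in> region ` set (leaf_cells (caterpillar u) (half c (\<not> b) q))"
    then have "region (half c b q) \<subseteq> region (half c (\<not> b) q)"
      using leaf_cells_subset by blast
    then show False using region_half_subset_half by blast
  qed
  have "?A = ?A'"
    using eq notin[of w] notin[of v] by (simp only: same insert_ident not_False_eq_True)
  then show ?case
    using Cons.IH[of "half c (\<not> b) q" v] same Cons.prems(2) unfolding cb w' by simp
qed simp

lemma leaf_cells_height_exponent:
  "p \<in> set (leaf_cells T q) \<Longrightarrow> height_exponent q \<le> height_exponent p"
proof (induction T arbitrary: q)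
  case (Caret c T U)
  have "height_exponent q \<le> height_exponent (half c b q)" for b
    by (cases q; cases c) auto
  moreover from Caret.prems
  have "p \<in> set (leaf_cells T (half c False q)) \<or> p \<in> set (leaf_cells U (half c True q))"
    by simp
  ultimately show ?case using Caret.IH order_trans by blast
qed simp

lemma mem_region_iff:
  "(u, v) \<in> region (r, i, s, j) \<longleftrightarrow>
     real i < 2 ^ r * u \<and> 2 ^ r * u \<le> real i + 1 \<and> real j < 2 ^ s * v \<and> 2 ^ s * v \<le> real j + 1"
  by (simp only: region.simps dyadic_rect_def mem_Sigma_iff mem_dyadic_interval_iff conj_assoc)

text \<open>If a dyadic interval contains \<open>2 ^ k / 2 ^ n\<close> and does not start at \<open>0\<close>, then it is shorter than
  \<open>2 ^ k / 2 ^ n\<close>, which is therefore a multiple of its length. As the interval is half-open,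
  \<open>2 ^ k / 2 ^ n\<close> is its right endpoint, and no larger point belongs to it.\<close>

lemma dyadic_interval_contains_two_powers:
  assumes "real a < 2 ^ r * (2 ^ k / 2 ^ n)" "2 ^ r * (2 ^ l / 2 ^ n) \<le> real a + 1" "k < l"
  shows "a = 0"
proof (rule ccontr)
  assume "a \<noteq> 0"
  have "real (a * 2 ^ n) < real (2 ^ (r + k))" "real (2 ^ (r + l)) \<le> real ((a + 1) * 2 ^ n)"
    using assms(1,2) by (simp_all add: field_simps power_add)
  then have le: "a * 2 ^ n < 2 ^ (r + k)" "2 ^ (r + l) \<le> (a + 1) * 2 ^ n"
    by (simp_all only: of_nat_less_iff of_nat_le_iff)
  have "2 ^ n \<le> a * 2 ^ n" using \<open>a \<noteq> 0\<close> by simp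
  then have "(2::nat) ^ n < 2 ^ (r + k)" using le(1) by linarith
  then have n: "n \<le> r + k" by (simp add: power_strict_increasing_iff)
  then have split: "(2::nat) ^ (r + k) = 2 ^ (r + k - n) * 2 ^ n"
    by (metis le_add_diff_inverse2 power_add)
  then have "a < 2 ^ (r + k - n)" using le(1) by simp
  then have "(a + 1) * 2 ^ n \<le> 2 ^ (r + k)" unfolding split by (intro mult_le_mono1) simp
  moreover have "(2::nat) ^ (r + k) < 2 ^ (r + l)"
    using assms(3) by (simp add: power_strict_increasing_iff)
  ultimately show False using le(2) by linarith
qed

text \<open>The hypothesis on exponents says that the two thinnest strips of the comb have images of
  different heights. The conclusion is about all diagrams of \<open>f\<close>, with carets of either type.\<close>

lemma comb_diagram_minimal:
  assumes f: "represents (left_comb n) \<pi> U f" and "n \<ge> 1"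
    and depth: "height_exponent (leaf_cells U root_cell ! \<pi> 0) \<noteq> height_exponent (leaf_cells U root_cell ! \<pi> 1)"
    and g: "represents T \<sigma> V f"
  shows "carets T \<ge> n"
proof (rule ccontr)
  assume few: "\<not> carets T \<ge> n"
  define x where "x k = (2 ^ k / 2 ^ n :: real)" for k :: nat
  have x: "0 < x k \<and> x k \<le> 1" if "k \<le> n" for k
    using that by (simp add: x_def)
  have "\<exists>i<leaves T. (x k, 1) \<in> region (leaf_cells T root_cell ! i)" if "k \<le> n" for k
    using unit_square_leaf[of "(x k, 1)" T] x[OF that] by (auto simp: unit_square_def)
  then obtain ix where ix: "\<And>k. k \<le> n \<Longrightarrow> ix k < leaves T \<and> (x k, 1) \<in> region (leaf_cells T root_cell ! ix k)"
    by metis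
  \<comment> \<open>\<open>(x k, 1)\<close> is the top right corner of strip \<open>k\<close>; there are more corners than leaves of \<open>T\<close>.\<close>
  have "\<not> inj_on ix {..n}"
  proof
    assume "inj_on ix {..n}"
    moreover have "ix ` {..n} \<subseteq> {..<leaves T}" using ix by auto
    ultimately have "card {..n} \<le> card {..<leaves T}" by (metis card_inj_on_le finite_lessThan)
    then show False using few by (simp add: leaves_eq_carets)
  qed
  then obtain k l where kl: "k < l" "l \<le> n" "ix k = ix l"
    unfolding inj_on_def by (metis atMost_iff linorder_neqE_nat)
  define q where "q = leaf_cells T root_cell ! ix l"
  have ixl: "ix l < leaves T" using ix kl by blast
  have mem: "(x k, 1) \<in> region q" "(x l, 1) \<in> region q"
    using ix[of k] ix[of l] kl by (simp_all add: q_def)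
  obtain r a s b where q: "q = (r, a, s, b)" by (metis prod_cases4)
  have ra: "real a < 2 ^ r * x k" "2 ^ r * x l \<le> real a + 1" and b: "real b < 2 ^ s" "2 ^ s \<le> real b + 1"
    using mem unfolding q mem_region_iff by simp_all
  have a: "a = 0"
    using dyadic_interval_contains_two_powers[of a r k n l] ra kl unfolding x_def by simp
  \<comment> \<open>A second height inside \<open>q\<close>, so that the vertical slope of \<open>f\<close> can be measured at \<open>x 0\<close> and \<open>x 1\<close>.\<close>
  define v where "v = (real b + 1 / 2) / 2 ^ s"
  have v: "2 ^ s * v = real b + 1 / 2" by (simp add: v_def)
  have "b < 2 ^ s" using b(1) by (metis of_nat_less_iff of_nat_numeral of_nat_power)
  then have "real b + 1 \<le> 2 ^ s"
    by (metis Suc_eq_plus1 Suc_leI of_nat_1 of_nat_add of_nat_le_iff of_nat_numeral of_nat_power)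
  then have v01: "0 < v" "v < 1" by (simp_all add: v_def)
  have in_q: "(x e, y) \<in> region q" if "e \<le> 1" "y = 1 \<or> y = v" for e y
  proof -
    have "x e \<le> x l" using that kl by (simp add: x_def divide_right_mono power_increasing)
    then have "2 ^ r * x e \<le> 1" using ra(2) a by (smt (verit) mult_left_mono of_nat_0 zero_le_power)
    moreover have "0 < 2 ^ r * x e" using x[of e] that kl by simp
    ultimately show ?thesis using that(2) b v unfolding q a mem_region_iff by auto
  qed
  obtain r' a' s' b' where q': "leaf_cells V root_cell ! \<sigma> (ix l) = (r', a', s', b')"
    by (metis prod_cases4)
  have new: "snd (f (x e, y)) = (2 ^ s * y - real b + real b') / 2 ^ s'" if "e \<le> 1" "y = 1 \<or> y = v" for e y
  proof -
    have "f (x e, y) = stretch q (r', a', s', b') (x e, y)"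
      using g in_q[OF that] ixl unfolding represents_iff_stretch q_def q'[symmetric] by blast
    then show ?thesis by (simp add: q)
  qed
  have comb: "leaf_cells (left_comb n) root_cell ! e = (n, e, 0, 0)" if "e \<le> 1" for e
    using leaf_cells_left_comb[of "n - 1" 0] \<open>n \<ge> 1\<close> that by (cases e) auto
  have old: "snd (f (x e, y)) = (y + real (snd (snd (snd (leaf_cells U root_cell ! \<pi> e))))) /
      2 ^ height_exponent (leaf_cells U root_cell ! \<pi> e)" if "e \<le> 1" "y = 1 \<or> y = v" for e y
  proof -
    have "e = 0 \<or> e = 1" using that by linarith
    then have "(x e, y) \<in> region (n, e, 0, 0)"
      using that(2) v01 unfolding mem_region_iff by (auto simp: x_def)
    moreover have "e < leaves (left_comb n)"
      using that(1) \<open>n \<ge> 1\<close> by (simp add: leaves_eq_carets)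
    ultimately have "f (x e, y) = stretch (n, e, 0, 0) (leaf_cells U root_cell ! \<pi> e) (x e, y)"
      using f comb[OF that(1)] unfolding represents_iff_stretch by metis
    then show ?thesis by (cases "leaf_cells U root_cell ! \<pi> e") simp
  qed
  have "(1 - v) / 2 ^ height_exponent (leaf_cells U root_cell ! \<pi> e) = 2 ^ s * (1 - v) / 2 ^ s'"
    if "e \<le> 1" for e
    using new[OF that, of 1] new[OF that, of v] old[OF that, of 1] old[OF that, of v]
    by (simp add: add_divide_distrib diff_divide_distrib right_diff_distrib)
  from this[of 0] this[of 1]
  have "(2::real) ^ height_exponent (leaf_cells U root_cell ! \<pi> 0) = 2 ^ height_exponent (leaf_cells U root_cell ! \<pi> 1)"
    using v01 by (simp add: frac_eq_eq)
  then show False using depth by simp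
qed

lemma represents_target_regions:
  assumes "represents T \<pi> U f"
  shows "region ` set (leaf_cells U root_cell) =
    (\<lambda>i. f ` region (leaf_cells T root_cell ! i)) ` {..<leaves T}"
proof -
  have lv: "leaves T = leaves U" and perm: "\<pi> permutes {..<leaves T}"
    using assms unfolding represents_def tree_pair_diagram_def by blast+
  have "set (leaf_cells U root_cell) = (!) (leaf_cells U root_cell) ` {..<leaves U}"
    by (metis atLeast_upt image_set length_leaf_cells map_nth)
  also have "{..<leaves U} = \<pi> ` {..<leaves T}" by (simp only: permutes_image[OF perm] lv[symmetric])
  finally show ?thesis
    using represents_image[OF assms] by (simp add: image_image)
qed

text \<open>The first two carets put the left half of the square, of full height, at leaf \<open>0\<close> and make
  every other leaf at most half as high.\<close>

abbreviation framed_caterpillar :: "(caret_type \<times> bool) list \<Rightarrow> two_type_tree" where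
  "framed_caterpillar w \<equiv> caterpillar ((Vertical, False) # (Horizontal, False) # w)"

text \<open>The partition of the target is the set of images of the leaf rectangles of \<open>T\<close>, hence depends on
  \<open>f\<close> and \<open>T\<close> only.\<close>

lemma represents_caterpillar_inj:
  assumes "represents T \<pi> (caterpillar w) f" "represents T \<pi>' (caterpillar w') f"
  shows "w = w' \<and> \<pi> = \<pi>'"
proof -
  have "leaves T = leaves (caterpillar w)" "leaves T = leaves (caterpillar w')"
    and perm: "\<pi> permutes {..<leaves T}" "\<pi>' permutes {..<leaves T}"
    using assms unfolding represents_def tree_pair_diagram_def by blast+
  then have "length w = length w'" by (simp add: leaves_eq_carets)
  moreover have "region ` set (leaf_cells (caterpillar w) root_cell) =
      region ` set (leaf_cells (caterpillar w') root_cell)"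
    by (simp only: represents_target_regions[OF assms(1)] represents_target_regions[OF assms(2)])
  ultimately have w: "w = w'" by (rule caterpillar_inj[rotated])
  have "\<pi> i = \<pi>' i" for i
  proof (cases "i < leaves T")
    case True
    then have "region (leaf_cells (caterpillar w) root_cell ! \<pi> i) =
        region (leaf_cells (caterpillar w) root_cell ! \<pi>' i)"
      using represents_image[OF assms(1) True] represents_image[OF assms(2) True] w by simp
    moreover have "\<pi> i < leaves (caterpillar w)" "\<pi>' i < leaves (caterpillar w)"
      using assms True w tree_pair_diagram_less unfolding represents_def by blast+
    ultimately show ?thesis using leaf_cells_region_inj by blast
  next
    case False
    then show ?thesis using perm by (simp add: permutes_not_in)
  qed
  then show ?thesis using w by blast
qed

text \<open>As \<open>\<pi>\<close> fixes \<open>0\<close>, the thinnest strip goes to the half of full height and its neighbour to a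
  lower rectangle, so \<open>comb_diagram_minimal\<close> applies.\<close>

lemma framed_caterpillar_in_H_set:
  assumes "length w + 3 = n" "\<pi> permutes {1..n}"
  shows "\<exists>f\<in>H_set n. represents (left_comb n) \<pi> (framed_caterpillar w) f"
proof -
  let ?U = "framed_caterpillar w"
  have "\<pi> permutes {..<leaves (left_comb n)}"
    by (rule permutes_subset[OF assms(2)]) (auto simp: leaves_eq_carets)
  then have D: "tree_pair_diagram (left_comb n) \<pi> ?U"
    using assms(1) by (simp add: tree_pair_diagram_def leaves_eq_carets del: caterpillar.simps)
  then obtain f where f: "represents (left_comb n) \<pi> ?U f" using represents_exists by blast
  let ?tail = "leaf_cells (caterpillar ((Horizontal, False) # w)) (1, 1, 0, 0)"
  have U: "leaf_cells ?U root_cell = (1, 0, 0, 0) # ?tail" by simp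
  have tail: "1 \<le> height_exponent p" if "p \<in> set ?tail" for p
    using that leaf_cells_height_exponent[of p "caterpillar w" "(1, 1, 1, 1)"] by auto
  have "\<pi> 0 = 0" using assms(2) by (simp add: permutes_not_in)
  have "\<pi> 1 < leaves ?U"
    using tree_pair_diagram_less[OF D] assms(1) by (simp add: leaves_eq_carets del: caterpillar.simps)
  moreover have "\<pi> 1 \<noteq> 0"
    using permutes_inj[OF assms(2)] \<open>\<pi> 0 = 0\<close> by (metis injD zero_neq_one)
  ultimately have "leaf_cells ?U root_cell ! \<pi> 1 = ?tail ! (\<pi> 1 - 1)" "\<pi> 1 - 1 < length ?tail"
    unfolding U by (simp_all add: leaves_eq_carets nth_Cons_pos del: caterpillar.simps)
  then have "leaf_cells ?U root_cell ! \<pi> 1 \<in> set ?tail" by (metis nth_mem)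
  then have "height_exponent (leaf_cells ?U root_cell ! \<pi> 0) \<noteq> height_exponent (leaf_cells ?U root_cell ! \<pi> 1)"
    using tail unfolding \<open>\<pi> 0 = 0\<close> by (fastforce simp: U simp del: caterpillar.simps)
  then have min: "\<not> representable_with m f" if "m < n" for m
    using comb_diagram_minimal[OF f] that assms(1) unfolding representable_with_def by fastforce
  have "f \<in> carrier two_V" using f by (auto simp: two_V_def simp del: caterpillar.simps)
  moreover have "representable_with n f"
    unfolding representable_with_def using f carets_left_comb by blast
  ultimately show ?thesis using min f unfolding H_set_def by blast
qed

lemma card_H_set_ge:
  assumes "n \<ge> 3"
  shows "4 ^ (n - 3) * fact n \<le> card (H_set n)"
proof -
  let ?W = "{w :: (caret_type \<times> bool) list. set w \<subseteq> UNIV \<and> length w = n - 3}"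
  let ?P = "{\<pi>. \<pi> permutes {1..n}}"
  have U: "(UNIV :: caret_type set) = {Vertical, Horizontal}" using caret_type.exhaust by auto
  have U2: "(UNIV :: (caret_type \<times> bool) set) = {Vertical, Horizontal} \<times> UNIV"
    by (simp flip: U)
  have "finite (UNIV :: (caret_type \<times> bool) set)" "card (UNIV :: (caret_type \<times> bool) set) = 4"
    unfolding U2 by (simp_all add: card_cartesian_product)
  then have "card ?W = 4 ^ (n - 3)" by (simp only: card_lists_length_eq)
  moreover have "card ?P = fact n" by (simp add: card_permutations)
  ultimately have card: "card (?W \<times> ?P) = 4 ^ (n - 3) * fact n" by (simp add: card_cartesian_product)
  define R where "R x f \<longleftrightarrow> f \<in> H_set n \<and> represents (left_comb n) (snd x) (framed_caterpillar (fst x)) f"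
    for x f
  define F where "F x = (SOME f. R x f)" for x
  have F: "R x (F x)" if "x \<in> ?W \<times> ?P" for x
  proof -
    have "length (fst x) + 3 = n" "snd x permutes {1..n}"
      using assms that by auto
    then have "\<exists>f. R x f" unfolding R_def using framed_caterpillar_in_H_set by blast
    then show ?thesis unfolding F_def by (rule someI_ex)
  qed
  have "inj_on F (?W \<times> ?P)"
  proof (rule inj_onI)
    fix x y assume xy: "x \<in> ?W \<times> ?P" "y \<in> ?W \<times> ?P" "F x = F y"
    have "R x (F x)" "R y (F x)"
      using F[OF xy(1)] F[OF xy(2)] xy(3) by simp_all
    then have "represents (left_comb n) (snd x) (framed_caterpillar (fst x)) (F x)"
      "represents (left_comb n) (snd y) (framed_caterpillar (fst y)) (F x)"
      unfolding R_def by blast+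
    from represents_caterpillar_inj[OF this] show "x = y" by (simp add: prod_eq_iff)
  qed
  moreover have "F ` (?W \<times> ?P) \<subseteq> H_set n"
    using F unfolding R_def by blast
  ultimately have "card (?W \<times> ?P) \<le> card (H_set n)" by (rule card_inj_on_le[OF _ _ finite_H_set])
  then show ?thesis by (simp only: card)
qed

section \<open>Counting words\<close>

text \<open>Inverses of generators are those of the structure with carrier \<open>C\<close>. They lie in \<open>C\<close> because \<open>C\<close>
  is generated by \<open>S\<close>, so that associativity of the ambient group \<open>B\<close> applies to them.\<close>

lemma generate_imp_word:
  assumes "group B" "C \<subseteq> carrier B" "S \<subseteq> C"
    and gen: "generate (B\<lparr>carrier := C\<rparr>) S = C" and x: "x \<in> C"
  shows "\<exists>ws. set ws \<subseteq> S \<union> m_inv (B\<lparr>carrier := C\<rparr>) ` S \<and> foldr (\<otimes>\<^bsub>B\<^esub>) ws \<one>\<^bsub>B\<^esub> = x"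
proof -
  interpret group B by fact
  let ?G = "B\<lparr>carrier := C\<rparr>"
  let ?A = "S \<union> m_inv ?G ` S"
  have A: "?A \<subseteq> carrier B"
    using assms(2,3) gen generate.inv[of _ S ?G] by auto
  have closed: "foldr (\<otimes>\<^bsub>B\<^esub>) ws \<one>\<^bsub>B\<^esub> \<in> carrier B" if "set ws \<subseteq> ?A" for ws
    using that A by (induction ws) auto
  have append: "foldr (\<otimes>\<^bsub>B\<^esub>) (us @ ws) \<one>\<^bsub>B\<^esub> = foldr (\<otimes>\<^bsub>B\<^esub>) us \<one>\<^bsub>B\<^esub> \<otimes>\<^bsub>B\<^esub> foldr (\<otimes>\<^bsub>B\<^esub>) ws \<one>\<^bsub>B\<^esub>"
    if "set us \<subseteq> ?A" "set ws \<subseteq> ?A" for us ws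
    using that(1)
  proof (induction us)
    case Nil
    then show ?case using closed[OF that(2)] by simp
  next
    case (Cons u us)
    then have "u \<in> carrier B" "set us \<subseteq> ?A" using A by auto
    then show ?case using Cons.IH closed that(2) by (simp add: m_assoc)
  qed
  have single: "foldr (\<otimes>\<^bsub>B\<^esub>) [h] \<one>\<^bsub>B\<^esub> = h" if "h \<in> ?A" for h
    using that A by auto
  have "x \<in> generate ?G S" using x gen by simp
  then show ?thesis
  proof induction
    case one
    then show ?case by (intro exI[of _ "[]"]) simp
  next
    case (incl h)
    then show ?case using single[of h] by (intro exI[of _ "[h]"]) auto
  next
    case (inv h)
    then show ?case using single[of "m_inv ?G h"] by (intro exI[of _ "[m_inv ?G h]"]) auto
  next
    case (eng h k)
    then obtain us ws where "set us \<subseteq> ?A" "foldr (\<otimes>\<^bsub>B\<^esub>) us \<one>\<^bsub>B\<^esub> = h"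
      "set ws \<subseteq> ?A" "foldr (\<otimes>\<^bsub>B\<^esub>) ws \<one>\<^bsub>B\<^esub> = k" by blast
    then show ?case using append[of us ws] by (intro exI[of _ "us @ ws"]) simp
  qed
qed

lemma word_length_attained:
  assumes "\<exists>ws. set ws \<subseteq> S \<union> m_inv G ` S \<and> foldr (\<otimes>\<^bsub>G\<^esub>) ws \<one>\<^bsub>G\<^esub> = x"
  shows "\<exists>ws. length ws = word_length G S x \<and> set ws \<subseteq> S \<union> m_inv G ` S \<and>
    foldr (\<otimes>\<^bsub>G\<^esub>) ws \<one>\<^bsub>G\<^esub> = x"
  unfolding word_length_def by (rule LeastI_ex) (use assms in blast)

lemma card_short_words:
  assumes "finite S" "card S \<ge> 1"
    and word: "\<And>x. x \<in> X \<Longrightarrow> \<exists>ws. set ws \<subseteq> S \<union> m_inv G ` S \<and> foldr (\<otimes>\<^bsub>G\<^esub>) ws \<one>\<^bsub>G\<^esub> = x"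
    and short: "\<And>x. x \<in> X \<Longrightarrow> word_length G S x \<le> L"
  shows "card X \<le> 2 * (2 * card S) ^ L"
proof -
  let ?A = "S \<union> m_inv G ` S"
  let ?W = "{ws. set ws \<subseteq> ?A \<and> length ws \<le> L}"
  have fin: "finite ?A" using assms(1) by simp
  have "card ?A \<le> card S + card (m_inv G ` S)" by (rule card_Un_le)
  then have A: "card ?A \<le> 2 * card S" using card_image_le[OF assms(1), of "m_inv G"] by simp
  have "X \<subseteq> (\<lambda>ws. foldr (\<otimes>\<^bsub>G\<^esub>) ws \<one>\<^bsub>G\<^esub>) ` ?W"
  proof
    fix x assume "x \<in> X"
    then obtain ws where "length ws = word_length G S x" "set ws \<subseteq> ?A" "foldr (\<otimes>\<^bsub>G\<^esub>) ws \<one>\<^bsub>G\<^esub> = x"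
      using word_length_attained[OF word] by blast
    then show "x \<in> (\<lambda>ws. foldr (\<otimes>\<^bsub>G\<^esub>) ws \<one>\<^bsub>G\<^esub>) ` ?W" using short[OF \<open>x \<in> X\<close>] by force
  qed
  then have "card X \<le> card ?W"
    using finite_lists_length_le[OF fin] by (rule surj_card_le[rotated])
  also have "\<dots> = (\<Sum>i\<le>L. card ?A ^ i)" by (rule card_lists_length_le[OF fin])
  also have "\<dots> \<le> (\<Sum>i\<le>L. (2 * card S) ^ i)" using A by (intro sum_mono power_mono) auto
  also have "\<dots> \<le> 2 * (2 * card S) ^ L"
  proof (induction L)
    case (Suc L)
    have "2 * (2 * card S) ^ L \<le> (2 * card S) ^ Suc L"
      using assms(2) by (simp only: power_Suc) (intro mult_le_mono1, simp)
    then show ?case using Suc by (simp only: sum.atMost_Suc)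
  qed simp
  finally show ?thesis .
qed

text \<open>A single term of the exponential series gives \<open>n ^ n / n! \<le> exp n\<close>. The bound \<open>exp 1 \<le> 3\<close> is
  enough, since the targets contribute a factor of \<open>4\<close> per caret.\<close>

lemma fact_ge_power_third: "(real n / 3) ^ n \<le> fact n"
proof -
  have "(\<Sum>k\<in>{n}. inverse (fact k) * real n ^ k) \<le> (\<Sum>k. inverse (fact k) * real n ^ k)"
    by (rule sum_le_suminf[OF summable_exp]) auto
  then have "real n ^ n / fact n \<le> exp (real n)"
    by (simp add: exp_def field_simps)
  also have "exp (real n) = exp 1 ^ n" by (simp flip: exp_of_nat_mult)
  also have "\<dots> \<le> 3 ^ n" by (intro power_mono exp_le) simp
  finally show ?thesis by (simp add: power_divide field_simps)
qed

lemma power_floor_le_self_power: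
  assumes "d \<ge> 1" "n \<ge> 1" "real L \<le> real n * log (2 * real d) (real n)"
  shows "real ((2 * d) ^ L) \<le> real n ^ n"
proof -
  have "real ((2 * d) ^ L) = (2 * real d) powr real L"
    using assms(1) by (simp add: powr_realpow)
  also have "\<dots> \<le> (2 * real d) powr (log (2 * real d) (real n) * real n)"
    using assms by (intro powr_mono) (simp_all add: mult.commute)
  also have "\<dots> = ((2 * real d) powr log (2 * real d) (real n)) powr real n"
    by (simp add: powr_powr)
  also have "\<dots> = real n powr real n"
    using assms by (subst powr_log_cancel) auto
  also have "\<dots> = real n ^ n" using assms(2) by (simp add: powr_realpow)
  finally show ?thesis .
qed

theorem theorem4p2:
  fixes S :: "(real \<times> real \<Rightarrow> real \<times> real) set" and d :: nat
  assumes "finite S" and "card S = d"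
    and "S \<subseteq> carrier two_V" and "generate two_V S = carrier two_V"
  shows "\<exists>C \<rho> :: real. C > 0 \<and> 0 < \<rho> \<and> \<rho> < 1 \<and>
    (\<forall>n \<ge> 1. 1 - real (card {x \<in> H_set n. real (word_length two_V S x) >
                                  real n * log (2 * real d) (real n)}) / real (card (H_set n))
              \<le> C * \<rho> ^ n)"
proof -
  let ?B = "BijGroup unit_square"
  have V: "two_V = ?B\<lparr>carrier := carrier two_V\<rparr>" by (simp add: two_V_def)
  have mult: "(\<otimes>\<^bsub>two_V\<^esub>) = (\<otimes>\<^bsub>?B\<^esub>)" and one: "\<one>\<^bsub>two_V\<^esub> = \<one>\<^bsub>?B\<^esub>" by (simp_all add: two_V_def)
  have sub: "carrier two_V \<subseteq> carrier ?B"
    by (auto simp: two_V_def BijGroup_def represents_def)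
  have word: "\<exists>ws. set ws \<subseteq> S \<union> m_inv two_V ` S \<and> foldr (\<otimes>\<^bsub>two_V\<^esub>) ws \<one>\<^bsub>two_V\<^esub> = x"
    if "x \<in> carrier two_V" for x
    using generate_imp_word[OF group_BijGroup sub assms(3) _ that] assms(4)
    unfolding mult one V[symmetric] by blast
  \<comment> \<open>Without generators the group would be trivial.\<close>
  have "d \<ge> 1"
  proof (rule ccontr)
    assume "\<not> d \<ge> 1"
    then have "card S = 0" using assms(2) by simp
    then have "S = {}" using assms(1) by simp
    then have "carrier two_V \<subseteq> {\<one>\<^bsub>two_V\<^esub>}" using word by fastforce
    then have "H_set 3 \<subseteq> {\<one>\<^bsub>two_V\<^esub>}" by (auto simp: H_set_def)
    then have "card (H_set 3) \<le> 1" by (metis card.empty card_insert_disjoint card_mono empty_iff finite.emptyI finite_insert One_nat_def)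
    then show False using card_H_set_ge[of 3] by (simp add: fact_numeral)
  qed
  have "1 - real (card {x \<in> H_set n. real (word_length two_V S x) > real n * log (2 * real d) (real n)})
      / real (card (H_set n)) \<le> 128 * (3 / 4) ^ n" (is "1 - real (card ?good) / _ \<le> _") if "n \<ge> 1" for n
  proof (cases "n \<ge> 3")
    case False
    \<comment> \<open>For \<open>n < 3\<close> the bound exceeds \<open>1\<close>.\<close>
    have "(3 / 4 :: real) ^ 2 \<le> (3 / 4) ^ n"
      using False by (intro power_decreasing) auto
    moreover have "0 \<le> real (card ?good) / real (card (H_set n))" by simp
    ultimately have "1 - real (card ?good) / real (card (H_set n)) \<le> 1" "1 \<le> 128 * (3 / 4 :: real) ^ n"
      by (simp_all add: power2_eq_square)
    then show ?thesis by (rule order_trans)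
  next
    case True
    let ?b = "real n * log (2 * real d) (real n)"
    define bad where "bad = {x \<in> H_set n. real (word_length two_V S x) \<le> ?b}"
    have "H_set n = ?good \<union> bad" "?good \<inter> bad = {}" by (auto simp: bad_def)
    then have split: "real (card (H_set n)) = real (card ?good) + real (card bad)"
    proof -
      have "finite ?good" "finite bad" using finite_H_set[of n] by (simp_all add: bad_def)
      then have "card (?good \<union> bad) = card ?good + card bad"
        using \<open>?good \<inter> bad = {}\<close> by (rule card_Un_disjoint)
      then show ?thesis by (simp only: \<open>H_set n = ?good \<union> bad\<close>[symmetric] of_nat_add)
    qed
    have b0: "?b \<ge> 0" using \<open>d \<ge> 1\<close> \<open>n \<ge> 1\<close> by simp
    define L where "L = nat \<lfloor>?b\<rfloor>"
    have L: "real L \<le> ?b" using b0 by (simp add: L_def)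
    have "card bad \<le> 2 * (2 * card S) ^ L"
    proof (rule card_short_words[OF assms(1)])
      show "1 \<le> card S" using \<open>d \<ge> 1\<close> assms(2) by simp
      show "\<exists>ws. set ws \<subseteq> S \<union> m_inv two_V ` S \<and> foldr (\<otimes>\<^bsub>two_V\<^esub>) ws \<one>\<^bsub>two_V\<^esub> = x" if "x \<in> bad" for x
        using word that by (auto simp: bad_def H_set_def)
      show "word_length two_V S x \<le> L" if "x \<in> bad" for x
        using that unfolding bad_def L_def by (simp add: le_nat_floor)
    qed
    then have "real (card bad) \<le> 2 * real ((2 * d) ^ L)"
      unfolding assms(2) by (metis of_nat_le_iff of_nat_mult of_nat_numeral)
    then have bad: "real (card bad) \<le> 2 * real n ^ n"
      using power_floor_le_self_power[OF \<open>d \<ge> 1\<close> that L] by linarith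
    have "(4::real) ^ n = 4 ^ (n - 3) * 64"
      using True power_add[of "4::real" "n - 3" 3] by simp
    then have "(4 / 3) ^ n * real n ^ n / 64 = 4 ^ (n - 3) * (real n / 3) ^ n"
      by (simp add: power_divide)
    also have "\<dots> \<le> 4 ^ (n - 3) * fact n"
      by (intro mult_left_mono fact_ge_power_third) simp
    also have "\<dots> = real (4 ^ (n - 3) * fact n)" by simp
    also have "\<dots> \<le> real (card (H_set n))"
      using card_H_set_ge[OF True] by (simp only: of_nat_le_iff)
    finally have H: "(4 / 3) ^ n * real n ^ n / 64 \<le> real (card (H_set n))" .
    have pos: "0 < (4 / 3) ^ n * real n ^ n / 64" using that by simp
    then have "card (H_set n) > 0" using H by linarith
    then have "1 - real (card ?good) / real (card (H_set n)) = real (card bad) / real (card (H_set n))"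
      using split by (simp add: field_simps)
    also have "\<dots> \<le> (2 * real n ^ n) / ((4 / 3) ^ n * real n ^ n / 64)"
      by (intro frac_le bad H pos) simp
    also have "\<dots> = 128 * (3 / 4) ^ n"
      using that by (simp add: power_divide field_simps)
    finally show ?thesis .
  qed
  then show ?thesis by (intro exI[of _ 128] exI[of _ "3 / 4"]) auto
qed

end
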